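(* For all integers $d\ge 1$ and $k\ge 3^{d-1}$, every finite $d$-degenerate graph has an equitable partition into $k$ induced forests.
   Context: A graph $G$ is $d$-degenerate if every subgraph of $G$ contains a vertex of degree at most $d$. An equitable partition of $G$ into $k$ parts is a partition of its vertex set into $k$ sets $S_1,\dots,S_k$ (some possibly empty) with $||S_i|-|S_j||\le 1$ for all $i,j$; it is a partition into induced forests if each part induces a forest (acyclic graph) in $G$. *)

theory Defs
  imports "Graph_Theory.Digraph_Component" "HOL-Library.Disjoint_Sets"
begin

text \<open>
  A finite simple graph is an element of the locale \<^locale>\<open>graph\<close>: a finite, loop-free,
  symmetric digraph without parallel arcs, in which every edge is represented by its two
  opposite arcs. Consequently the degree of a vertex is its \<^const>\<open>out_degree\<close>, and a subgraph
  of the undirected graph is a \<^const>\<open>subgraph\<close> that is itself a \<^locale>\<open>graph\<close>. The null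
  graph has no vertex at all, so it is exempted in the following definition.
\<close>

definition degenerate :: "nat \<Rightarrow> ('a, 'b) pre_digraph \<Rightarrow> bool" where
  "degenerate d G \<longleftrightarrow>
     (\<forall>H. graph H \<and> subgraph H G \<and> verts H \<noteq> {} \<longrightarrow> (\<exists>v\<in>verts H. out_degree H v \<le> d))"

text \<open>
  The predicate \<^const>\<open>forest\<close> is not the undirected notion: the two arcs of a single edge
  already form a \<^const>\<open>pre_digraph.cycle\<close> (of length 2). Undirected cycles are those of
  length at least 3.
\<close>

definition undirected_forest :: "('a, 'b) pre_digraph \<Rightarrow> bool" where
  "undirected_forest G \<longleftrightarrow> \<not> (\<exists>p. pre_digraph.cycle G p \<and> 3 \<le> length p)"

text \<open>
  The parts form an indexed family because several of them may be empty, so that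
  \<^const>\<open>partition_on\<close> does not apply.
\<close>

definition equitable_partition :: "'a set \<Rightarrow> nat \<Rightarrow> (nat \<Rightarrow> 'a set) \<Rightarrow> bool" where
  "equitable_partition V k S \<longleftrightarrow>
     (\<Union>i\<in>{1..k}. S i) = V \<and> disjoint_family_on S {1..k} \<and>
     (\<forall>i\<in>{1..k}. \<forall>j\<in>{1..k}. \<bar>int (card (S i)) - int (card (S j))\<bar> \<le> 1)"

end

theory Submission
  imports Defs
begin

text \<open>
  For \<open>d \<ge> 2\<close>, every \<open>d\<close>-degenerate graph splits equitably into three induced
  \<open>(d - 1)\<close>-degenerate graphs; iterating this \<open>d - 1\<close> times gives \<open>3 ^ (d - 1)\<close> forests. If
  \<open>k > 3 ^ (d - 1)\<close>, one of these forests has at least \<open>n div k\<close> vertices; we split off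
  exactly \<open>n div k\<close> of them as one part and continue with \<open>k - 1\<close>.

  For the splitting step, order the vertices so that each has at most \<open>d\<close> earlier neighbours, and
  give each vertex with exactly \<open>d\<close> of them two of these as parents. It suffices to find an
  equitable 3-colouring in which no vertex has the colour of both its parents. Let \<open>q\<close> be the last
  vertex that is a parent, \<open>C\<close> the set of its children (which are childless) and \<open>R\<close> the rest.
  If \<open>C\<close> has one element, colour last the block consisting of \<open>q\<close>, its child and the
  last vertex of \<open>R\<close>: three vertices that each forbid at most one colour can be given
  three different colours unless they all forbid the same one, and the child forbids nothing.
  Otherwise a set \<open>W\<close> of \<open>(card C - 2) mod 3\<close> children is coloured in a block with the last
  vertices of \<open>R\<close>, so that each member of \<open>W\<close> avoids the colour of its other parent; this only
  fails if the other parents of all children have one colour \<open>c\<close>. Then \<open>q\<close> gets a colour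
  \<open>x\<close> allowed by its own parents, different from \<open>c\<close> in the latter case, that occurs
  on at most half of the other parents of \<open>C - W\<close>, so that there are enough children which may be
  coloured \<open>x\<close> as well.
\<close>

subsection \<open>Equitable colourings\<close>

text \<open>Quantifying over ordered pairs bounds the difference of two class sizes in both
  directions without subtraction on \<open>nat\<close>.\<close>

definition equitable_coloring :: "nat \<Rightarrow> 'a set \<Rightarrow> ('a \<Rightarrow> nat) \<Rightarrow> bool" where
  "equitable_coloring k V f \<longleftrightarrow> f ` V \<subseteq> {..<k} \<and>
     (\<forall>i<k. \<forall>j<k. card {v \<in> V. f v = i} \<le> card {v \<in> V. f v = j} + 1)"

text \<open>Every class gains exactly \<open>t\<close> vertices, so the differences between class
  sizes are unchanged.\<close>

lemma equitable_coloring_extend: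
  assumes f: "equitable_coloring k R f" and fin: "finite R" "finite A" and disj: "R \<inter> A = {}"
    and h: "\<And>v. v \<in> R \<Longrightarrow> h v = f v" "h ` A \<subseteq> {..<k}"
    and const: "\<And>i. i < k \<Longrightarrow> card {v \<in> A. h v = i} = t"
  shows "equitable_coloring k (R \<union> A) h"
proof -
  have "card {v \<in> R \<union> A. h v = i} = card {v \<in> R. f v = i} + t" if "i < k" for i
  proof -
    have "{v \<in> R \<union> A. h v = i} = {v \<in> R. f v = i} \<union> {v \<in> A. h v = i}"
      using h(1) by auto
    moreover have "{v \<in> R. f v = i} \<inter> {v \<in> A. h v = i} = {}" using disj by auto
    ultimately show ?thesis using fin const[OF that] by (simp add: card_Un_disjoint)
  qed
  then show ?thesis using f h unfolding equitable_coloring_def by auto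
qed

lemma card_fibre_inj_le:
  assumes "inj_on g A" shows "card {v \<in> A. g v = i} \<le> 1"
proof (cases "{v \<in> A. g v = i} = {}")
  case False
  then obtain x where "x \<in> A" "g x = i" by auto
  with assms have "{v \<in> A. g v = i} = {x}" by (auto dest: inj_onD)
  then show ?thesis by simp
next
  case True
  then show ?thesis by (simp only: card.empty)
qed

lemma card_fibre_bij:
  assumes "bij_betw g A B" "i \<in> B" shows "card {v \<in> A. g v = i} = 1"
proof -
  obtain x where "x \<in> A" "g x = i" using assms by (auto simp: bij_betw_def)
  with assms have "{v \<in> A. g v = i} = {x}" by (auto simp: bij_betw_def dest: inj_onD)
  then show ?thesis by simp
qed

section \<open>Distinct colours for at most three vertices\<close>

text \<open>Each of the three conditions excludes at most two of the six permutations of the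
  colours. All six are excluded only if these pairs are disjoint, which forces
  \<open>p = q = s\<close>. A value of 3 or more excludes nothing.\<close>

lemma avoiding_permutation_of_three:
  fixes p q s :: nat
  assumes "\<not> (p = q \<and> q = s \<and> s < 3)"
  shows "\<exists>i<3. \<exists>j<3. \<exists>k<3. i \<noteq> j \<and> j \<noteq> k \<and> i \<noteq> k \<and> i \<noteq> p \<and> j \<noteq> q \<and> k \<noteq> s"
proof (rule ccontr)
  assume none: "\<not> ?thesis"
  have "i = p \<or> j = q \<or> k = s" if "i < 3" "j < 3" "k < 3" "i \<noteq> j" "j \<noteq> k" "i \<noteq> k" for i j k
    using none that by blast
  from this[of 0 1 2] this[of 0 2 1] this[of 1 0 2] this[of 1 2 0] this[of 2 0 1] this[of 2 1 0]
  show False using assms by auto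
qed

lemma two_colors_avoiding:
  "\<exists>i<3. \<exists>j<3. i \<noteq> j \<and> i \<noteq> p \<and> j \<noteq> (p::nat)"
  using avoiding_permutation_of_three[of p p 3] by auto

lemma color_avoiding_two:
  "\<exists>i<3. i \<noteq> p \<and> i \<noteq> (q::nat)"
  using two_colors_avoiding[of p] by metis

text \<open>Colours a block of at most three vertices. That no colour is the value of
  \<open>F\<close> on all of \<open>B\<close> rules out the one obstruction left by
  \<open>avoiding_permutation_of_three\<close>, and makes \<open>B\<close> nonempty.\<close>

lemma avoiding_injection:
  fixes F :: "'a \<Rightarrow> nat"
  assumes "card B \<le> 3" "finite B" and F: "\<And>c. c < 3 \<Longrightarrow> \<exists>v\<in>B. F v \<noteq> c"
  shows "\<exists>g. inj_on g B \<and> g ` B \<subseteq> {..<3} \<and> (\<forall>v\<in>B. g v \<noteq> F v)"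
proof -
  have "B \<noteq> {}" using F[of 0] by auto
  then have "card B = 1 \<or> card B = 2 \<or> card B = 3"
    using assms(1,2) by (cases "card B" rule: nat.exhaust) (auto simp: card_gt_0_iff)
  then show ?thesis
  proof (elim disjE)
    assume "card B = 1"
    then obtain x where B: "B = {x}" by (auto simp: card_1_singleton_iff)
    have "F x \<ge> 3" using F[of "F x"] B by force
    then show ?thesis using B by (intro exI[of _ "\<lambda>_. 0"]) auto
  next
    assume "card B = 2"
    then obtain x y where B: "B = {x, y}" "x \<noteq> y" by (auto simp: card_2_iff)
    \<comment> \<open>A third value outside the colours stands for an absent vertex that forbids
      nothing.\<close>
    obtain i j :: nat where "i < 3" "j < 3" "i \<noteq> j" "i \<noteq> F x" "j \<noteq> F y"
      using avoiding_permutation_of_three[of "F x" "F y" 3] avoiding_permutation_of_three[of "F x" "F y" 4] by auto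
    then show ?thesis using B by (intro exI[of _ "\<lambda>v. if v = x then i else j"]) auto
  next
    assume "card B = 3"
    then obtain x y z where B: "B = {x, y, z}" "x \<noteq> y" "y \<noteq> z" "x \<noteq> z" by (auto simp: card_3_iff)
    have "\<not> (F x = F y \<and> F y = F z \<and> F z < 3)" using F[of "F z"] B(1) by force
    from avoiding_permutation_of_three[OF this]
    obtain i j k :: nat where "i < 3" "j < 3" "k < 3" "i \<noteq> j" "j \<noteq> k" "i \<noteq> k"
      "i \<noteq> F x" "j \<noteq> F y" "k \<noteq> F z" by blast
    then show ?thesis using B
      by (intro exI[of _ "\<lambda>v. if v = x then i else if v = y then j else k"]) auto
  qed
qed

section \<open>Equitability as floor and ceiling bounds\<close>

lemma sum_card_fibres:
  fixes f :: "'a \<Rightarrow> nat"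
  assumes "finite V" "f ` V \<subseteq> {..<k}"
  shows "(\<Sum>i<k. card {v \<in> V. f v = i}) = card V"
  using sum.group[OF assms(1) finite_lessThan assms(2), of "\<lambda>_. 1 :: nat"] by simp

text \<open>If one class were below the floor, all would be at most the floor and their sum would
  fall short of \<open>card V\<close>; the bound by the ceiling
  \<open>(card V + k - 1) div k\<close> is dual. Conversely, floor and ceiling differ by at most
  one.\<close>

lemma equitable_coloring_iff:
  assumes "finite V" "k > 0"
  shows "equitable_coloring k V f \<longleftrightarrow> f ` V \<subseteq> {..<k} \<and>
    (\<forall>i<k. card V div k \<le> card {v \<in> V. f v = i} \<and> card {v \<in> V. f v = i} \<le> (card V + k - 1) div k)"
    (is "_ \<longleftrightarrow> _ \<and> ?bounds")
proof (cases "f ` V \<subseteq> {..<k}")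
  case True
  let ?c = "\<lambda>i. card {v \<in> V. f v = i}"
  have sum: "(\<Sum>i<k. ?c i) = card V" using sum_card_fibres[OF assms(1) True] .
  have "(card V + k - 1) div k \<le> card V div k + 1"
    using div_le_mono[of "card V + k - 1" "card V + k" k] assms(2) by simp
  moreover have "?bounds" if eq: "\<And>i j. i < k \<Longrightarrow> j < k \<Longrightarrow> ?c i \<le> ?c j + 1"
  proof (intro allI impI conjI)
    fix i assume i: "i < k"
    show "card V div k \<le> ?c i"
    proof (rule ccontr)
      assume less: "\<not> ?thesis"
      have "?c j \<le> card V div k" if "j < k" for j using eq[OF that i] less by linarith
      then have "(\<Sum>i<k. ?c i) < (\<Sum>i<k. card V div k)"
        using less i by (intro sum_strict_mono_ex1 bexI[of _ i]) auto
      moreover have "k * (card V div k) \<le> card V" by simp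
      ultimately show False using sum by simp
    qed
    show "?c i \<le> (card V + k - 1) div k"
    proof (rule ccontr)
      assume less: "\<not> ?thesis"
      have "(card V + k - 1) div k \<le> ?c j" if "j < k" for j using eq[OF i that] less by linarith
      then have "(\<Sum>i<k. (card V + k - 1) div k) < (\<Sum>i<k. ?c i)"
        using less i by (intro sum_strict_mono_ex1 bexI[of _ i]) auto
      moreover have "card V + k - 1 < k * ((card V + k - 1) div k) + k"
        using dividend_less_div_times[of k "card V + k - 1"] assms(2) by (simp add: mult.commute)
      ultimately show False using sum by simp
    qed
  qed
  moreover have "?c i \<le> ?c j + 1" if "?bounds" "i < k" "j < k" for i j
    using that calculation(1) by (meson add_le_mono1 le_trans)
  ultimately show ?thesis using True unfolding equitable_coloring_def by blast
qed (simp add: equitable_coloring_def)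

subsection \<open>Three-colourings avoiding monochromatic families\<close>

text \<open>An abstract form of the colouring problem: \<open>D\<close> holds the vertices with
  chosen parents \<open>a v\<close> and \<open>b v\<close>, and \<open>r\<close> is the position in
  the ordering, so that parents come earlier.\<close>

locale parent_pairs =
  fixes D :: "'a set" and a b :: "'a \<Rightarrow> 'a" and r :: "'a \<Rightarrow> nat"
  assumes rank: "v \<in> D \<Longrightarrow> r (a v) < r v" "v \<in> D \<Longrightarrow> r (b v) < r v"
    and parents_distinct: "v \<in> D \<Longrightarrow> a v \<noteq> b v"
begin

definition parent_closed :: "'a set \<Rightarrow> bool" where
  "parent_closed V \<longleftrightarrow> (\<forall>v \<in> V \<inter> D. a v \<in> V \<and> b v \<in> V)"

definition proper :: "'a set \<Rightarrow> ('a \<Rightarrow> nat) \<Rightarrow> bool" where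
  "proper V f \<longleftrightarrow> (\<forall>v \<in> V \<inter> D. \<not> (f v = f (a v) \<and> f v = f (b v)))"

text \<open>The value 3 stands for ``no colour is forbidden''.\<close>
definition forbidden :: "'a set \<Rightarrow> ('a \<Rightarrow> nat) \<Rightarrow> 'a \<Rightarrow> nat" where
  "forbidden R f v = (if v \<in> D \<and> a v \<in> R \<and> b v \<in> R \<and> f (a v) = f (b v) then f (a v) else 3)"

text \<open>A remaining vertex of maximal rank is a parent of no remaining vertex, so such vertices
  can be removed one after another.\<close>

lemma parent_closed_remove_top:
  assumes "finite R" "parent_closed R" "t \<le> card R"
  shows "\<exists>U\<subseteq>R. card U = t \<and> parent_closed (R - U)"
  using assms(3)
proof (induction t)
  case 0
  show ?case using assms by (intro exI[of _ "{}"]) auto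
next
  case (Suc t)
  then obtain U where U: "U \<subseteq> R" "card U = t" "parent_closed (R - U)" by auto
  have "finite (r ` (R - U))" "R - U \<noteq> {}" using assms U Suc.prems by auto
  then obtain v where v: "v \<in> R - U" "\<And>w. w \<in> R - U \<Longrightarrow> r w \<le> r v"
    using Max_in[of "r ` (R - U)"] Max_ge[of "r ` (R - U)"] by fastforce
  have "parent_closed (R - insert v U)"
    using U(3) v rank unfolding parent_closed_def by (metis Diff_iff IntE IntI insert_iff leD)
  moreover have "card (insert v U) = Suc t" using U v assms(1) finite_subset[of U R] by auto
  ultimately show ?case using U v by (intro exI[of _ "insert v U"]) auto
qed

section \<open>Extending colourings by blocks and by the children of a vertex\<close>

text \<open>The block \<open>U \<union> W\<close> gets distinct colours, so each class grows by one,
  or the block is everything. A vertex of \<open>U\<close> that agrees with both parents must have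
  them in \<open>R\<close>, which its forbidden colour excludes. Properness is claimed on
  \<open>R \<union> U\<close> only, because the vertices of \<open>W\<close> will be children of a
  vertex not yet coloured.\<close>

lemma extend_by_block:
  assumes fin: "finite R" "finite U" "finite W"
    and disj: "R \<inter> U = {}" "W \<inter> (R \<union> U) = {}"
    and cl: "parent_closed R" "parent_closed (R \<union> U)"
    and f: "equitable_coloring 3 R f" "proper R f"
    and g: "inj_on g (U \<union> W)" "g ` (U \<union> W) \<subseteq> {..<3}" "\<And>u. u \<in> U \<Longrightarrow> g u \<noteq> forbidden R f u"
    and size: "card (U \<union> W) = 3 \<or> R = {}"
    and h: "\<And>v. v \<in> R \<Longrightarrow> h v = f v" "\<And>v. v \<in> U \<union> W \<Longrightarrow> h v = g v"
  shows "equitable_coloring 3 (R \<union> U \<union> W) h" "proper (R \<union> U) h"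
proof -
  have injh: "inj_on h (U \<union> W)" and imh: "h ` (U \<union> W) \<subseteq> {..<3}"
    using g(1,2) h(2) by (auto simp: inj_on_def)
  show "equitable_coloring 3 (R \<union> U \<union> W) h"
  proof (cases "R = {}")
    case True
    have "card {v \<in> U \<union> W. h v = i} \<le> card {v \<in> U \<union> W. h v = j} + 1" for i j
      using card_fibre_inj_le[OF injh, of i] by linarith
    then show ?thesis using imh True unfolding equitable_coloring_def by auto
  next
    case False
    then have "card (h ` (U \<union> W)) = 3" using size injh by (simp add: card_image)
    then have "h ` (U \<union> W) = {..<3}"
      using imh by (intro card_subset_eq) auto
    then have bij: "bij_betw h (U \<union> W) {..<3}" using injh by (simp add: bij_betw_def)
    have "equitable_coloring 3 (R \<union> (U \<union> W)) h"
      by (rule equitable_coloring_extend[OF f(1), where t = 1])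
         (use fin disj h imh card_fibre_bij[OF bij] in auto)
    then show ?thesis by (simp add: Un_assoc)
  qed
  show "proper (R \<union> U) h"
    unfolding proper_def
  proof (intro ballI notI)
    fix v assume v: "v \<in> (R \<union> U) \<inter> D" and eq: "h v = h (a v) \<and> h v = h (b v)"
    show False
    proof (cases "v \<in> R")
      case True
      then have "a v \<in> R" "b v \<in> R" using v cl(1) by (auto simp: parent_closed_def)
      then show False using True v eq f(2) h(1) by (auto simp: proper_def)
    next
      case False
      then have vU: "v \<in> U" using v by auto
      have par: "a v \<in> R \<union> U" "b v \<in> R \<union> U" using v cl(2) by (auto simp: parent_closed_def)
      have "v \<noteq> a v" "v \<noteq> b v" using rank[of v] v by auto
      then have "a v \<notin> U" "b v \<notin> U" using injh eq vU by (auto dest: inj_onD)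
      then have "a v \<in> R" "b v \<in> R" using par by auto
      then show False using g(3)[OF vU] h v vU eq by (auto simp: forbidden_def)
    qed
  qed
qed


text \<open>Here \<open>p w\<close> is the parent of \<open>w\<close> other than \<open>q\<close>.
  Together with \<open>q\<close>, the \<open>3 * s + 2\<close> children outside \<open>W\<close>
  form three groups of size \<open>s + 1\<close>, one per colour. The group of \<open>q\<close> has
  a colour \<open>x\<close> and contains only children whose other parent is not coloured
  \<open>x\<close>; the other two groups differ from \<open>q\<close> and are harmless.\<close>

lemma extend_by_children:
  assumes fin: "finite R" "finite C" and disj: "q \<notin> R" "q \<notin> C" "R \<inter> C = {}"
    and cl: "parent_closed R" "q \<in> D \<Longrightarrow> a q \<in> R \<and> b q \<in> R"
    and p: "\<And>w. w \<in> C \<Longrightarrow> p w \<in> R \<and> {a w, b w} = {q, p w}"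
    and W: "W \<subseteq> C" "card (C - W) = 3 * s + 2"
    and f: "equitable_coloring 3 (R \<union> W) f" "proper R f"
    and fW: "(\<forall>w\<in>W. f w \<noteq> f (p w)) \<or> (\<exists>c. \<forall>w\<in>C. f (p w) = c)"
  shows "\<exists>h. equitable_coloring 3 (R \<union> C \<union> {q}) h \<and> proper (R \<union> C \<union> {q}) h"
proof -
  define y where "y = forbidden R f q"
  define good where "good x = {w \<in> C - W. f (p w) \<noteq> x}" for x
  \<comment> \<open>The colour \<open>x\<close> must be allowed for \<open>q\<close>, leave
    \<open>s\<close> children able to share it, and create no violation in \<open>W\<close>, whose
    colours are already fixed.\<close>
  have "\<exists>x<3. x \<noteq> y \<and> s \<le> card (good x) \<and> (\<forall>w\<in>W. f w \<noteq> f (p w) \<or> f (p w) \<noteq> x)"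
  proof (cases "\<exists>c. \<forall>w\<in>C. f (p w) = c")
    case True
    then obtain c where c: "\<And>w. w \<in> C \<Longrightarrow> f (p w) = c" by auto
    obtain x :: nat where x: "x < 3" "x \<noteq> y" "x \<noteq> c"
      using color_avoiding_two by metis
    then have "good x = C - W" using c by (auto simp: good_def)
    then have "s \<le> card (good x)" using W by simp
    moreover have "f (p w) \<noteq> x" if "w \<in> W" for w using c[of w] x(3) that W(1) by auto
    ultimately show ?thesis using x by blast
  next
    case False
    then have neq: "\<And>w. w \<in> W \<Longrightarrow> f w \<noteq> f (p w)" using fW by auto
    obtain x1 x2 :: nat where x: "x1 < 3" "x2 < 3" "x1 \<noteq> x2" "x1 \<noteq> y" "x2 \<noteq> y"
      using two_colors_avoiding by metis
    have "finite (C - W)" using fin by simp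
    \<comment> \<open>The other parent of a child cannot have both colours, so each child is good
      for \<open>x1\<close> or for \<open>x2\<close>, and one of the two suits enough
      children.\<close>
    have "good x1 \<union> good x2 = C - W" using x by (auto simp: good_def)
    then have "3 * s + 2 \<le> card (good x1) + card (good x2)"
      using card_Un_le[of "good x1" "good x2"] W(2) by simp
    then have "s \<le> card (good x1) \<or> s \<le> card (good x2)" by linarith
    then show ?thesis using x neq by blast
  qed
  then obtain x where x: "x < 3" "x \<noteq> y" "s \<le> card (good x)"
      "\<And>w. w \<in> W \<Longrightarrow> f w \<noteq> f (p w) \<or> f (p w) \<noteq> x" by blast
  obtain i j :: nat where ij: "i < 3" "j < 3" "i \<noteq> j" "i \<noteq> x" "j \<noteq> x"
    using two_colors_avoiding by metis
  obtain X where X: "X \<subseteq> good x" "card X = s" using x(3) obtain_subset_with_card_n by metis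
  have finCW: "finite (C - W)" using fin by simp
  have XC: "X \<subseteq> C - W" using X by (auto simp: good_def)
  then have "card (C - W - X) = 2 * s + 2"
    using W(2) X(2) finCW by (simp add: card_Diff_subset finite_subset)
  then obtain Y where Y: "Y \<subseteq> C - W - X" "card Y = s + 1"
    using obtain_subset_with_card_n[of "s + 1" "C - W - X"] by auto
  define Z where "Z = C - W - X - Y"
  have finXY: "finite X" "finite Y" using XC Y finCW finite_subset by blast+
  have cardZ: "card Z = s + 1"
    using \<open>card (C - W - X) = 2 * s + 2\<close> Y finXY by (simp add: Z_def card_Diff_subset)
  define h where "h v = (if v \<in> insert q X then x else if v \<in> Y then i else if v \<in> Z then j else f v)" for v
  define A where "A = insert q (C - W)"
  have A: "A = insert q X \<union> Y \<union> Z" using XC Y by (auto simp: A_def Z_def)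
  have hR: "h v = f v" if "v \<in> R \<union> W" for v
    using that disj W XC Y by (auto simp: h_def Z_def)
  have qXYZ: "q \<notin> X" "q \<notin> Y" "q \<notin> Z" using XC Y disj by (auto simp: Z_def)
  have fib: "{v \<in> A. h v = x} = insert q X" "{v \<in> A. h v = i} = Y" "{v \<in> A. h v = j} = Z"
    using ij Y qXYZ by (auto simp: A h_def Z_def)
  have all: "c = x \<or> c = i \<or> c = j" if "c < 3" for c using that x(1) ij by linarith
  have "equitable_coloring 3 ((R \<union> W) \<union> A) h"
  proof (rule equitable_coloring_extend[OF f(1)])
    show "card {v \<in> A. h v = c} = s + 1" if "c < 3" for c
      using all[OF that] fib X(2) Y(2) cardZ qXYZ finXY by (elim disjE) auto
    show "h ` A \<subseteq> {..<3}" using x(1) ij by (auto simp: A h_def)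
    show "finite A" "(R \<union> W) \<inter> A = {}" using fin disj W by (auto simp: A_def)
    show "finite (R \<union> W)" using fin W finite_subset by auto
  qed (use hR in auto)
  moreover have "(R \<union> W) \<union> A = R \<union> C \<union> {q}" using W by (auto simp: A_def)
  moreover have "proper (R \<union> C \<union> {q}) h"
    unfolding proper_def
  proof (intro ballI notI)
    fix v assume v: "v \<in> (R \<union> C \<union> {q}) \<inter> D" and eq: "h v = h (a v) \<and> h v = h (b v)"
    consider "v \<in> R" | "v \<in> C" | "v = q" using v by auto
    then show False
    proof cases
      case 1
      then have "a v \<in> R" "b v \<in> R" using v cl(1) by (auto simp: parent_closed_def)
      then show False using 1 v eq f(2) hR by (auto simp: proper_def)
    next
      case 2
      have "h q = x" by (simp add: h_def)
      have "h (p v) = f (p v)" using hR p[OF 2] by simp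
      moreover have "h v = h q" "h v = h (p v)"
        using eq p[OF 2] by (metis doubleton_eq_iff)+
      ultimately have vx: "h v = x" "f (p v) = x" using \<open>h q = x\<close> by auto
      \<comment> \<open>A violating child has colour \<open>x\<close>, as has its other parent. In
        \<open>W\<close> this contradicts the choice of \<open>x\<close>; outside \<open>W\<close>
        the child lies in \<open>X\<close>, hence is good for \<open>x\<close>.\<close>
      show False
      proof (cases "v \<in> W")
        case True
        then show False using hR[of v] vx x(4)[of v] by auto
      next
        case False
        then have "v \<in> A" "v \<noteq> q" using 2 disj by (auto simp: A_def)
        then have "v \<in> X" using fib(1) vx by auto
        then show False using X vx by (auto simp: good_def)
      qed
    next
      case 3
      have "h q = x" by (simp add: h_def)
      then show False using cl(2) hR x(2) eq v 3 by (auto simp: y_def forbidden_def)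
    qed
  qed
  ultimately show ?thesis by auto
qed

text \<open>The vertex \<open>u\<close> has no pair of parents in \<open>R\<close>, so it forbids
  nothing and the three vertices of the block cannot all forbid the same colour.\<close>

lemma extend_by_unconstrained_block:
  assumes fin: "finite R" "finite U" and disj: "R \<inter> U = {}"
    and cl: "parent_closed R" "parent_closed (R \<union> U)"
    and f: "equitable_coloring 3 R f" "proper R f"
    and U: "card U = 3" and u: "u \<in> U" "u \<in> D \<Longrightarrow> a u \<in> U \<or> b u \<in> U"
  shows "\<exists>h. equitable_coloring 3 (R \<union> U) h \<and> proper (R \<union> U) h"
proof -
  have "forbidden R f u = 3" using u disj by (auto simp: forbidden_def)
  then have "\<exists>v\<in>U. forbidden R f v \<noteq> c" if "c < 3" for c
    using u(1) that by (intro bexI[of _ u]) auto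
  then obtain g where g: "inj_on g U" "g ` U \<subseteq> {..<3}" "\<forall>v\<in>U. g v \<noteq> forbidden R f v"
    using avoiding_injection[of U "forbidden R f"] U fin by auto
  define h where "h v = (if v \<in> U then g v else f v)" for v
  have "h v = f v" if "v \<in> R" for v using that disj by (auto simp: h_def)
  moreover have "h v = g v" if "v \<in> U \<union> {}" for v using that by (simp add: h_def)
  ultimately show ?thesis
    using extend_by_block[OF fin(1,2) finite.emptyI disj _ cl f, of g h] g U by auto
qed

text \<open>The set \<open>W\<close> shares a block with the last vertices of \<open>R\<close>. If
  all values to be avoided in the block agree, one member of \<open>W\<close> is exchanged for a
  child with another value. If there is no such child, the other parents of all children have one
  colour, which is the second alternative.\<close>

lemma extend_by_top_and_children:
  assumes fin: "finite R" "finite C" and disj: "R \<inter> C = {}"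
    and cl: "parent_closed R" and R: "R \<noteq> {}" and p: "\<And>w. w \<in> C \<Longrightarrow> p w \<in> R"
    and t: "1 \<le> t" "t \<le> 2" "t \<le> card C"
    and IH: "\<And>S. S \<subset> R \<Longrightarrow> parent_closed S \<Longrightarrow> \<exists>f. equitable_coloring 3 S f \<and> proper S f"
  shows "\<exists>W f. W \<subseteq> C \<and> card W = t \<and> equitable_coloring 3 (R \<union> W) f \<and> proper R f \<and>
           ((\<forall>w\<in>W. f w \<noteq> f (p w)) \<or> (\<exists>c. \<forall>w\<in>C. f (p w) = c))"
proof -
  \<comment> \<open>If \<open>R\<close> has fewer than \<open>3 - t\<close> vertices, the block
    swallows all of it and may have fewer than three elements, since \<open>S\<close> is then
    empty.\<close>
  define u where "u = min (3 - t) (card R)"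
  have u: "1 \<le> u" using fin R t by (auto simp: u_def Suc_le_eq card_gt_0_iff)
  obtain U where U: "U \<subseteq> R" "card U = u" "parent_closed (R - U)"
    using parent_closed_remove_top[OF fin(1) cl, of u] by (auto simp: u_def)
  define S where "S = R - U"
  have SU: "R = S \<union> U" "S \<inter> U = {}" using U by (auto simp: S_def)
  have finU: "finite U" "finite S" using fin U finite_subset by (auto simp: S_def)
  have Une: "U \<noteq> {}" using U u by auto
  then have "S \<subset> R" using U by (auto simp: S_def)
  then obtain f where f: "equitable_coloring 3 S f" "proper S f" using IH U S_def by blast
  have S_empty: "S = {}" if "card R \<le> 3 - t"
    using that U fin card_subset_eq[of R U] by (simp add: u_def S_def)
  have glue: "\<exists>h. equitable_coloring 3 (R \<union> W) h \<and> proper R h \<and> (\<forall>v\<in>S. h v = f v) \<and> (\<forall>v\<in>U \<union> W. h v = g v)"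
    if W: "W \<subseteq> C" "card W = t" and g: "inj_on g (U \<union> W)" "g ` (U \<union> W) \<subseteq> {..<3}"
      "\<And>u. u \<in> U \<Longrightarrow> g u \<noteq> forbidden S f u" for W g
  proof -
    have finW: "finite W" using W fin finite_subset by auto
    have "W \<inter> (S \<union> U) = {}" using W disj SU by auto
    then have "card (U \<union> W) = u + t" using finU finW U W by (subst card_Un_disjoint) auto
    then have "card (U \<union> W) = 3 \<or> S = {}" using S_empty t by (auto simp: u_def min_def)
    moreover define h where "h v = (if v \<in> S then f v else g v)" for v
    moreover have hS: "h v = f v" if "v \<in> S" for v using that by (simp add: h_def)
    moreover have hU: "h v = g v" if "v \<in> U \<union> W" for v
      using that SU \<open>W \<inter> (S \<union> U) = {}\<close> by (auto simp: h_def)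
    moreover have "parent_closed S" using U(3) by (simp add: S_def)
    moreover have "parent_closed (S \<union> U)" using cl SU(1) by simp
    ultimately show ?thesis
      using extend_by_block[OF finU(2,1) finW SU(2) \<open>W \<inter> (S \<union> U) = {}\<close> _ _ f g, of h] SU(1)
      by blast
  qed
  have size: "finite (U \<union> W)" "card (U \<union> W) \<le> 3" if "W \<subseteq> C" "card W = t" for W
  proof -
    show "finite (U \<union> W)" using that finU fin finite_subset by auto
    show "card (U \<union> W) \<le> 3" using card_Un_le[of U W] that U t by (simp add: u_def)
  qed
  \<comment> \<open>A child whose other parent lies in \<open>U\<close> needs no forbidden value:
    both are in the block and get different colours anyway.\<close>
  define F where "F v = (if v \<in> U then forbidden S f v else if p v \<in> S then f (p v) else 3)" for v
  have from_block: ?thesis if W: "W \<subseteq> C" "card W = t" and F: "\<And>c. c < 3 \<Longrightarrow> \<exists>v \<in> U \<union> W. F v \<noteq> c" for W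
  proof -
    obtain g where g: "inj_on g (U \<union> W)" "g ` (U \<union> W) \<subseteq> {..<3}" "\<forall>v \<in> U \<union> W. g v \<noteq> F v"
      using avoiding_injection[OF size(2,1)[OF W] F] by auto
    have gU: "g v \<noteq> forbidden S f v" if "v \<in> U" for v using bspec[OF g(3), of v] that by (simp add: F_def)
    obtain h where h: "equitable_coloring 3 (R \<union> W) h" "proper R h"
        "\<And>v. v \<in> S \<Longrightarrow> h v = f v" "\<And>v. v \<in> U \<union> W \<Longrightarrow> h v = g v"
      using glue[OF W g(1,2) gU] by blast
    have "h w \<noteq> h (p w)" if w: "w \<in> W" for w
    proof (cases "p w \<in> S")
      case True
      have "w \<notin> U" using w W disj SU by auto
      then have "g w \<noteq> f (p w)" using bspec[OF g(3), of w] w True by (simp add: F_def)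
      then show ?thesis using h(3)[OF True] h(4)[of w] w by simp
    next
      case False
      then have "p w \<in> U" using p w W SU by auto
      moreover have "w \<noteq> p w" using w W p disj by (metis IntI empty_iff subsetD)
      ultimately show ?thesis using h(4) g(1) w by (metis UnI1 UnI2 inj_onD)
    qed
    then show ?thesis using W h by blast
  qed
  obtain W0 where W0: "W0 \<subseteq> C" "card W0 = t" using t(3) obtain_subset_with_card_n by metis
  show ?thesis
  proof (cases "\<exists>c<3. \<forall>v \<in> U \<union> W0. F v = c")
    case False
    then show ?thesis using from_block[OF W0] by blast
  next
    case True
    then obtain c where c: "c < 3" "\<And>v. v \<in> U \<union> W0 \<Longrightarrow> F v = c" by auto
    show ?thesis
    proof (cases "\<exists>w\<in>C. F w \<noteq> c")
      case True
      then obtain w where w: "w \<in> C" "F w \<noteq> c" by auto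
      have "t - 1 \<le> card (C - {w})" using w t fin by simp
      then obtain W1 where W1: "W1 \<subseteq> C - {w}" "card W1 = t - 1" using obtain_subset_with_card_n by metis
      then have "finite W1" "w \<notin> W1" using fin finite_subset by auto
      then have W: "insert w W1 \<subseteq> C" "card (insert w W1) = t" using W1 w t by auto
      show ?thesis
      proof (rule from_block[OF W])
        fix c' :: nat
        \<comment> \<open>The exchange leaves \<open>U\<close> untouched, so the value
          \<open>c\<close> survives beside the different value of \<open>w\<close>.\<close>
        obtain x where "x \<in> U" "F x = c" using Une c(2) by blast
        then show "\<exists>v \<in> U \<union> insert w W1. F v \<noteq> c'"
          using w(2) by (metis UnI1 UnI2 insertI1)
      qed
    next
      case False
      then have all: "\<And>w. w \<in> C \<Longrightarrow> p w \<in> S \<and> f (p w) = c"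
        using disj SU c(1) by (auto simp: F_def split: if_splits)
      obtain w where w: "w \<in> W0" using W0 t by (metis card.empty ex_in_conv not_one_le_zero)
      have "w \<notin> U" using w W0 disj SU by auto
      \<comment> \<open>In this alternative the members of \<open>W0\<close> need not avoid
        anything, so they get the value 3, and \<open>w\<close> prevents a common forbidden
        colour.\<close>
      then have free: "\<exists>v\<in>U \<union> W0. (if v \<in> U then forbidden S f v else 3) \<noteq> c" if "c < 3" for c
        using w that by (intro bexI[of _ w]) auto
      obtain g where g: "inj_on g (U \<union> W0)" "g ` (U \<union> W0) \<subseteq> {..<3}"
          "\<forall>v \<in> U \<union> W0. g v \<noteq> (if v \<in> U then forbidden S f v else 3)"
        using avoiding_injection[OF size(2,1)[OF W0] free] by blast
      have gU: "g v \<noteq> forbidden S f v" if "v \<in> U" for v using bspec[OF g(3), of v] that by simp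
      obtain h where h: "equitable_coloring 3 (R \<union> W0) h" "proper R h" "\<And>v. v \<in> S \<Longrightarrow> h v = f v"
        using glue[OF W0 g(1,2) gU] by blast
      have "\<forall>w\<in>C. h (p w) = c" using all h(3) by auto
      then show ?thesis using W0 h by blast
    qed
  qed
qed

section \<open>Existence of the three-colouring\<close>

text \<open>Strong induction on \<open>card V\<close>. At most three vertices get distinct colours;
  if no vertex has parents, any three form a block; otherwise the last parent \<open>q\<close> and
  its children are treated.\<close>

lemma equitable_proper_3_coloring:
  assumes "finite V" "parent_closed V"
  shows "\<exists>f. equitable_coloring 3 V f \<and> proper V f"
  using assms
proof (induction "card V" arbitrary: V rule: less_induct)
  case less
  note fin = less.prems(1) and cl = less.prems(2)
  have IH: "\<exists>f. equitable_coloring 3 S f \<and> proper S f" if "S \<subset> V" "parent_closed S" for S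
    using less.hyps[of S] that fin psubset_card_mono finite_subset by (metis psubset_imp_subset)
  have block: ?case if U: "U \<subseteq> V" "card U = 3" "parent_closed (V - U)" "u \<in> U" "u \<in> D \<Longrightarrow> a u \<in> U \<or> b u \<in> U" for U u
  proof -
    have "V - U \<subset> V" "V - U \<union> U = V" using U by auto
    moreover obtain f where "equitable_coloring 3 (V - U) f" "proper (V - U) f"
      using IH[of "V - U"] U calculation by auto
    ultimately show ?thesis
      using extend_by_unconstrained_block[of "V - U" U f u] fin U cl finite_subset by auto
  qed
  have leaves: "parent_closed (V - L)" if "\<And>v w. v \<in> V \<inter> D \<Longrightarrow> w \<in> L \<Longrightarrow> v \<in> L \<or> (a v \<noteq> w \<and> b v \<noteq> w)" for L
    using cl that unfolding parent_closed_def by (metis Diff_iff IntD1 IntD2 IntI)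
  show ?case
  proof (cases "card V \<le> 3")
    case True
    obtain g :: "'a \<Rightarrow> nat" where "bij_betw g V {0..<card V}" using ex_bij_betw_finite_nat[OF fin] by auto
    then have g: "inj_on g V" "g ` V \<subseteq> {..<3}" using True by (auto simp: bij_betw_def)
    have "g u \<noteq> forbidden {} g u" if "u \<in> V" for u using g(2) that by (auto simp: forbidden_def)
    moreover have "parent_closed {}" "equitable_coloring 3 {} g" "proper {} g"
      by (auto simp: parent_closed_def proper_def equitable_coloring_def)
    ultimately show ?thesis
      using extend_by_block[of "{}" V "{}" g g g] fin cl g by auto
  next
    case False
    show ?thesis
    proof (cases "V \<inter> D = {}")
      case True
      obtain U where U: "U \<subseteq> V" "card U = 3" using False obtain_subset_with_card_n[of 3 V] by auto
      then obtain u where "u \<in> U" by (metis card.empty ex_in_conv zero_neq_numeral)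
      moreover have "parent_closed (V - U)" using True by (auto simp: parent_closed_def)
      moreover have "u \<notin> D" using True U \<open>u \<in> U\<close> by blast
      ultimately show ?thesis using block[OF U] by blast
    next
      case nonempty: False
      define P where "P = a ` (V \<inter> D) \<union> b ` (V \<inter> D)"
      have "finite P" "P \<noteq> {}" using fin nonempty by (auto simp: P_def)
      then obtain q where q: "q \<in> P" "\<And>w. w \<in> P \<Longrightarrow> r w \<le> r q"
        using Max_in[of "r ` P"] Max_ge[of "r ` P"] by fastforce
      have "P \<subseteq> V" using cl by (auto simp: P_def parent_closed_def)
      define C where "C = {v \<in> V \<inter> D. a v = q \<or> b v = q}"
      have rC: "r q < r w" if "w \<in> C" for w using that rank[of w] by (auto simp: C_def)
      \<comment> \<open>A child of \<open>q\<close> outranks every parent, so it is childless. Hence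
        removing \<open>q\<close> and all its children leaves a parent-closed set.\<close>
      have CP: "w \<notin> P" if "w \<in> C" for w using rC[OF that] q(2)[of w] by linarith
      define R where "R = V - insert q C"
      define p where "p w = (if a w = q then b w else a w)" for w
      have qV: "q \<in> V" "q \<notin> C" using q \<open>P \<subseteq> V\<close> rC by auto
      have V: "V = R \<union> C \<union> {q}" using qV by (auto simp: R_def C_def)
      have finRC: "finite R" "finite C" using fin by (auto simp: R_def C_def)
      have C_childless: "a v \<notin> C" "b v \<notin> C" if "v \<in> V \<inter> D" for v
        using that CP by (auto simp: P_def)
      have clR: "parent_closed R"
        unfolding R_def by (rule leaves) (use C_childless in \<open>auto simp: C_def\<close>)
      have p: "p w \<in> R \<and> {a w, b w} = {q, p w}" if w: "w \<in> C" for w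
      proof -
        have wVD: "w \<in> V \<inter> D" using w by (auto simp: C_def)
        then have "a w \<in> V" "b w \<in> V" using cl by (auto simp: parent_closed_def)
        then show ?thesis
          using w C_childless[OF wVD] parents_distinct[of w] by (auto simp: p_def R_def C_def)
      qed
      have "C \<noteq> {}" using q by (auto simp: P_def C_def)
      then obtain w where w: "w \<in> C" by auto
      then have Rne: "R \<noteq> {}" using p by auto
      have dRC: "R \<inter> C = {}" "q \<notin> R" by (auto simp: R_def)
      show ?thesis
      proof (cases "card C = 1")
        case True
        then have C: "C = {w}" using w by (auto simp: card_1_singleton_iff)
        \<comment> \<open>A last vertex of \<open>R\<close> completes \<open>q\<close> and its only
          child \<open>w\<close> to a block of three; \<open>w\<close> is unconstrained because its
          parent \<open>q\<close> is in the block.\<close>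
        obtain U where U: "U \<subseteq> R" "card U = 1" "parent_closed (R - U)"
          using parent_closed_remove_top[OF finRC(1) clR, of 1] finRC Rne by (auto simp: Suc_le_eq card_gt_0_iff)
        then obtain u where u: "U = {u}" by (auto simp: card_1_singleton_iff)
        have "V - {q, w, u} = R - U" using V C u U dRC qV by auto
        then have "parent_closed (V - {q, w, u})" using U(3) by simp
        moreover have "{q, w, u} \<subseteq> V" using V U(1) u w by auto
        moreover have "a w \<in> {q, w, u} \<or> b w \<in> {q, w, u}" using w by (auto simp: C_def)
        moreover have "q \<noteq> w" "q \<noteq> u" "w \<noteq> u" using u U dRC w qV by auto
        then have "card {q, w, u} = 3" by simp
        ultimately show ?thesis using block[of "{q, w, u}" w] by blast
      next
        case False
        then have C2: "card C \<ge> 2" using \<open>C \<noteq> {}\<close> finRC by (metis One_nat_def Suc_1 Suc_leI card_gt_0_iff le_neq_implies_less)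
        \<comment> \<open>The \<open>t\<close> surplus children are coloured beforehand as
          \<open>W\<close>, which leaves exactly the \<open>3 * s + 2\<close> children that
          \<open>extend_by_children\<close> expects.\<close>
        define s where "s = (card C - 2) div 3"
        define t where "t = (card C - 2) mod 3"
        have st: "card C = 3 * s + 2 + t" using C2 by (simp add: s_def t_def)
        have IHR: "\<exists>f. equitable_coloring 3 S f \<and> proper S f" if "S \<subseteq> R" "parent_closed S" for S
          using IH[of S] that qV by (auto simp: R_def)
        have "\<exists>W f. W \<subseteq> C \<and> card W = t \<and> equitable_coloring 3 (R \<union> W) f \<and> proper R f \<and>
           ((\<forall>w\<in>W. f w \<noteq> f (p w)) \<or> (\<exists>c. \<forall>w\<in>C. f (p w) = c))"
        proof (cases "t = 0")
          case True
          then show ?thesis using IHR[of R] clR by (intro exI[of _ "{}"]) auto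
        next
          case False
          have "t \<le> 2" by (simp add: t_def)
          then show ?thesis
            using extend_by_top_and_children[OF finRC dRC(1) clR Rne, of p t] False st p IHR by auto
        qed
        then obtain W f where W: "W \<subseteq> C" "card W = t" and f: "equitable_coloring 3 (R \<union> W) f" "proper R f"
          "(\<forall>w\<in>W. f w \<noteq> f (p w)) \<or> (\<exists>c. \<forall>w\<in>C. f (p w) = c)" by blast
        have "card (C - W) = 3 * s + 2" using W st finRC by (simp add: card_Diff_subset finite_subset)
        moreover have "a q \<in> R \<and> b q \<in> R" if "q \<in> D"
        proof -
          have "q \<in> V \<inter> D" using qV that by simp
          moreover have "a q \<noteq> q" "b q \<noteq> q" using rank[OF that] by auto
          ultimately show ?thesis using C_childless[of q] cl by (auto simp: R_def parent_closed_def)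
        qed
        ultimately show ?thesis
          using extend_by_children[OF finRC dRC(2) qV(2) dRC(1) clR _ p W(1) _ f] V by auto
      qed
    qed
  qed
qed

end

subsection \<open>Splitting degenerate sets\<close>

text \<open>Phrased for an adjacency relation and vertex subsets, that is, for induced subgraphs, so
  that colour classes can be treated as plain sets.\<close>

definition degenerate_on :: "nat \<Rightarrow> ('a \<Rightarrow> 'a \<Rightarrow> bool) \<Rightarrow> 'a set \<Rightarrow> bool" where
  "degenerate_on d E V \<longleftrightarrow> (\<forall>W\<subseteq>V. W \<noteq> {} \<longrightarrow> (\<exists>v\<in>W. card {u \<in> W. E v u} \<le> d))"

lemma degenerate_on_subset: "degenerate_on d E V \<Longrightarrow> U \<subseteq> V \<Longrightarrow> degenerate_on d E U"
  unfolding degenerate_on_def by blast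

text \<open>A vertex with at most \<open>d\<close> neighbours is placed last, and the rest is ranked
  recursively.\<close>

lemma degenerate_on_ranking:
  assumes "finite V" "degenerate_on d E V"
  shows "\<exists>r :: 'a \<Rightarrow> nat. inj_on r V \<and> (\<forall>v\<in>V. card {u \<in> V. E v u \<and> r u < r v} \<le> d)"
  using assms
proof (induction "card V" arbitrary: V)
  case 0
  then show ?case by auto
next
  case (Suc n)
  then have "V \<noteq> {}" by auto
  then obtain v where v: "v \<in> V" "card {u \<in> V. E v u} \<le> d"
    using Suc.prems by (auto simp: degenerate_on_def)
  have "n = card (V - {v})" using Suc v by simp
  then obtain r :: "'a \<Rightarrow> nat" where r: "inj_on r (V - {v})"
      "\<And>w. w \<in> V - {v} \<Longrightarrow> card {u \<in> V - {v}. E w u \<and> r u < r w} \<le> d"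
    using Suc.hyps(1)[of "V - {v}"] Suc.prems degenerate_on_subset[of d E V "V - {v}"] by auto
  \<comment> \<open>One more than the sum of all ranks exceeds each of them.\<close>
  define m where "m = Suc (\<Sum>u\<in>V. r u)"
  have m: "r u < m" if "u \<in> V" for u
    using that Suc.prems(1) by (simp add: m_def less_Suc_eq_le member_le_sum)
  define r' where "r' = r(v := m)"
  have "inj_on r' V"
    using r(1) m unfolding inj_on_def r'_def by (metis fun_upd_apply insertE insert_Diff less_irrefl v(1))
  moreover have "card {u \<in> V. E w u \<and> r' u < r' w} \<le> d" if w: "w \<in> V" for w
  proof (cases "w = v")
    case True
    have "card {u \<in> V. E w u \<and> r' u < r' w} \<le> card {u \<in> V. E v u}"
      using Suc.prems(1) True by (intro card_mono) auto
    then show ?thesis using v(2) by simp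
  next
    case False
    have "{u \<in> V. E w u \<and> r' u < r' w} = {u \<in> V - {v}. E w u \<and> r u < r w}"
      using False m[OF w] by (auto simp: r'_def)
    then show ?thesis using r(2)[of w] w False by simp
  qed
  ultimately show ?case by blast
qed

text \<open>In a subset of a colour class, all neighbours of the vertex \<open>v\<close> of highest
  rank are among the earlier neighbours \<open>N v\<close>. If there are \<open>Suc d\<close> of
  these, properness gives one of the two parents another colour, so at most \<open>d\<close>
  remain.\<close>

lemma degenerate_on_split_three:
  assumes fin: "finite V" and irr: "\<And>v. \<not> E v v"
    and deg: "degenerate_on (Suc d) E V" and d: "d \<ge> 1"
  shows "\<exists>f. equitable_coloring 3 V f \<and> (\<forall>i. degenerate_on d E {v \<in> V. f v = i})"
proof -
  obtain r :: "'a \<Rightarrow> nat" where r: "inj_on r V"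
      "\<And>v. v \<in> V \<Longrightarrow> card {u \<in> V. E v u \<and> r u < r v} \<le> Suc d"
    using degenerate_on_ranking[OF fin deg] by blast
  define N where "N v = {u \<in> V. E v u \<and> r u < r v}" for v
  have finN: "finite (N v)" for v using fin by (simp add: N_def)
  define D where "D = {v \<in> V. card (N v) = Suc d}"
  have "\<exists>x y. x \<in> N v \<and> y \<in> N v \<and> x \<noteq> y" if "v \<in> D" for v
  proof -
    have "card (N v) \<ge> 2" using that d by (simp add: D_def)
    then obtain T where "T \<subseteq> N v" "card T = 2" using obtain_subset_with_card_n by metis
    then show ?thesis by (auto simp: card_2_iff)
  qed
  then obtain a b where ab: "\<And>v. v \<in> D \<Longrightarrow> a v \<in> N v \<and> b v \<in> N v \<and> a v \<noteq> b v" by metis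
  interpret parent_pairs D a b r
    by unfold_locales (use ab in \<open>auto simp: N_def\<close>)
  have "parent_closed V" unfolding parent_closed_def using ab by (auto simp: N_def)
  then obtain f where f: "equitable_coloring 3 V f" "proper V f"
    using equitable_proper_3_coloring fin by blast
  have "degenerate_on d E {v \<in> V. f v = i}" for i
    unfolding degenerate_on_def
  proof (intro allI impI)
    fix W assume W: "W \<subseteq> {v \<in> V. f v = i}" "W \<noteq> {}"
    then have "W \<subseteq> V" by auto
    then have "finite (r ` W)" using finite_subset[OF _ fin] by auto
    then obtain v where v: "v \<in> W" "\<And>u. u \<in> W \<Longrightarrow> r u \<le> r v"
      using W(2) Max_in[of "r ` W"] Max_ge[of "r ` W"] by fastforce
    have "u \<in> N v" if "u \<in> W" "E v u" for u
    proof -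
      have "u \<noteq> v" using irr that by auto
      then have "r u \<noteq> r v" using r(1) W that v(1) by (auto dest: inj_onD)
      then show ?thesis using that v(2)[of u] W by (auto simp: N_def)
    qed
    then have sub: "{u \<in> W. E v u} \<subseteq> N v" by auto
    have "card {u \<in> W. E v u} \<le> d"
    proof (cases "v \<in> D")
      case True
      then have "v \<in> V \<inter> D" by (simp add: D_def)
      then have "f v \<noteq> f (a v) \<or> f v \<noteq> f (b v)" using f(2) unfolding proper_def by blast
      moreover have "f u = i" if "u \<in> W" for u using W that by blast
      ultimately have "a v \<notin> W \<or> b v \<notin> W" using v(1) by metis
      then have "{u \<in> W. E v u} \<subset> N v" using sub ab[OF True] by blast
      then have "card {u \<in> W. E v u} < card (N v)" using psubset_card_mono[OF finN] by blast
      then show ?thesis using True by (simp add: D_def)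
    next
      case False
      have "v \<in> V" using v W by auto
      then have "card (N v) \<le> d" using False r(2)[of v] by (simp add: D_def N_def)
      then show ?thesis using card_mono[OF finN sub] by linarith
    qed
    then show "\<exists>v\<in>W. card {u \<in> W. E v u} \<le> d" using v(1) by blast
  qed
  then show ?thesis using f(1) by blast
qed

section \<open>Refinement, iteration and further colours\<close>

text \<open>The pair of colours is encoded as a two-digit number with lower digit below
  \<open>k\<close>. Equitability survives because nested floors and nested ceilings compose:
  dividing by \<open>m\<close> and then by \<open>k\<close> amounts to dividing by
  \<open>m * k\<close>.\<close>

lemma equitable_coloring_refine:
  assumes fin: "finite V" and m: "m > 0" and k: "k > 0"
    and f: "equitable_coloring m V f"
    and g: "\<And>i. i < m \<Longrightarrow> equitable_coloring k {v \<in> V. f v = i} (g i)"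
  shows "equitable_coloring (m * k) V (\<lambda>v. k * f v + g (f v) v)"
proof -
  let ?n = "card V" and ?h = "\<lambda>v. k * f v + g (f v) v"
  have fV: "f v < m" if "v \<in> V" for v using f that by (auto simp: equitable_coloring_def)
  have gV: "g (f v) v < k" if "v \<in> V" for v
    using g[OF fV[OF that]] that by (auto simp: equitable_coloring_def)
  have range: "?h v < m * k" if "v \<in> V" for v
  proof -
    have "?h v < k * (f v + 1)" using gV[OF that] by simp
    also have "\<dots> \<le> k * m" using fV[OF that] by (intro mult_le_mono) auto
    finally show ?thesis by (simp add: mult.commute)
  qed
  have "?n div (m * k) \<le> card {v \<in> V. ?h v = i} \<and> card {v \<in> V. ?h v = i} \<le> (?n + m * k - 1) div (m * k)"
    if i: "i < m * k" for i
  proof -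
    define s where "s = i div k"
    define t where "t = i mod k"
    have st: "s < m" "t < k" using i k by (simp_all add: s_def t_def less_mult_imp_div_less)
    let ?S = "{v \<in> V. f v = s}"
    have "?h v = i \<longleftrightarrow> f v = s \<and> g s v = t" if "v \<in> V" for v
    proof
      assume "?h v = i"
      then have "i div k = f v" "i mod k = g (f v) v" using gV[OF that] by auto
      then show "f v = s \<and> g s v = t" by (simp add: s_def t_def)
    qed (simp add: s_def t_def)
    then have fib: "{v \<in> V. ?h v = i} = {v \<in> ?S. g s v = t}" by auto
    have S: "?n div m \<le> card ?S" "card ?S \<le> (?n + m - 1) div m"
      using f st fin m by (simp_all add: equitable_coloring_iff)
    have T: "card ?S div k \<le> card {v \<in> ?S. g s v = t}" "card {v \<in> ?S. g s v = t} \<le> (card ?S + k - 1) div k"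
      using g[OF st(1)] st(2) fin k by (simp_all add: equitable_coloring_iff)
    have "?n div (m * k) \<le> card ?S div k" using div_le_mono[OF S(1), of k] by (simp add: div_mult2_eq)
    moreover have "(card ?S + k - 1) div k \<le> ((?n + m - 1) div m + (k - 1)) div k"
      using S(2) k by (intro div_le_mono) auto
    moreover have "\<dots> = (?n + m * k - 1) div (m * k)"
    proof -
      \<comment> \<open>The rounding term \<open>k - 1\<close> of the outer ceiling is moved inside
        the inner division as \<open>(k - 1) * m\<close>.\<close>
      have "(?n + m - 1) div m + (k - 1) = (?n + m - 1 + (k - 1) * m) div m"
        using div_mult_self1[of m "?n + m - 1" "k - 1"] m by linarith
      also have "?n + m - 1 + (k - 1) * m = ?n + m * k - 1"
        using m k by (cases k) (auto simp: algebra_simps)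
      finally show ?thesis by (simp add: div_mult2_eq)
    qed
    ultimately show ?thesis using T fib by simp
  qed
  then show ?thesis using range fin m k by (subst equitable_coloring_iff) auto
qed

text \<open>Each split into three lowers the degeneracy by one, and the colourings are combined by
  refinement. Being 1-degenerate stands for inducing a forest.\<close>

lemma equitable_forests_power:
  assumes "finite V" "\<And>v. \<not> E v v" "degenerate_on (Suc d) E V"
  shows "\<exists>f. equitable_coloring (3 ^ d) V f \<and> (\<forall>i. degenerate_on 1 E {v \<in> V. f v = i})"
  using assms(1,3)
proof (induction d arbitrary: V)
  case 0
  have "equitable_coloring 1 V (\<lambda>_. 0)" by (auto simp: equitable_coloring_def)
  moreover have "degenerate_on 1 E {v \<in> V. 0 = i}" for i :: nat
    using degenerate_on_subset[of 1 E V "{v \<in> V. 0 = i}"] 0 by auto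
  ultimately show ?case by (intro exI[of _ "\<lambda>_. 0"]) simp
next
  case (Suc d)
  obtain f where f: "equitable_coloring 3 V f" "\<And>i. degenerate_on (Suc d) E {v \<in> V. f v = i}"
    using degenerate_on_split_three[OF Suc.prems(1) assms(2) Suc.prems(2)] by auto
  have "\<forall>i. \<exists>g. equitable_coloring (3 ^ d) {v \<in> V. f v = i} g \<and>
      (\<forall>j. degenerate_on 1 E {v \<in> {v \<in> V. f v = i}. g v = j})"
    using Suc.IH[OF _ f(2)] Suc.prems(1) by simp
  from choice[OF this] obtain g where g: "\<And>i. equitable_coloring (3 ^ d) {v \<in> V. f v = i} (g i)"
      "\<And>i j. degenerate_on 1 E {v \<in> {v \<in> V. f v = i}. g i v = j}" by blast
  let ?h = "\<lambda>v. 3 ^ d * f v + g (f v) v"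
  have "equitable_coloring (3 ^ Suc d) V ?h"
    using equitable_coloring_refine[OF Suc.prems(1) _ _ f(1) g(1)] by simp
  moreover have "degenerate_on 1 E {v \<in> V. ?h v = i}" for i
  proof (rule degenerate_on_subset[OF g(2)[of "i div 3 ^ d" "i mod 3 ^ d"]], safe)
    fix v assume v: "v \<in> V"
    have "f v < 3" using f(1) v by (auto simp: equitable_coloring_def)
    then have "g (f v) v < 3 ^ d" using g(1)[of "f v"] v by (auto simp: equitable_coloring_def)
    then show "f v = ?h v div 3 ^ d" "g (?h v div 3 ^ d) v = ?h v mod 3 ^ d" by auto
  qed
  ultimately show ?case by blast
qed

text \<open>Induction on \<open>k\<close>: a subset of a class of the colouring with
  \<open>3 ^ d\<close> colours becomes the new class, and the induction hypothesis colours the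
  rest.\<close>

lemma equitable_forests:
  assumes "finite V" "\<And>v. \<not> E v v" "degenerate_on (Suc d) E V" "3 ^ d \<le> k"
  shows "\<exists>f. equitable_coloring k V f \<and> (\<forall>i. degenerate_on 1 E {v \<in> V. f v = i})"
  using assms(4,1,3)
proof (induction k arbitrary: V rule: dec_induct)
  case base
  then show ?case using equitable_forests_power assms(2) by blast
next
  case (step k)
  have k: "0 < k" using step.hyps(1) by (metis gr0I le_zero_eq power_not_zero zero_neq_numeral)
  let ?n = "card V"
  obtain f where f: "equitable_coloring (3 ^ d) V f" "\<And>i. degenerate_on 1 E {v \<in> V. f v = i}"
    using equitable_forests_power[OF step.prems(1) assms(2) step.prems(2)] by blast
  \<comment> \<open>Since \<open>3 ^ d \<le> Suc k\<close>, class 0 has room for a new class of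
    exactly the floor size.\<close>
  have "?n div Suc k \<le> ?n div 3 ^ d" using step.hyps(1) by (intro div_le_mono2) auto
  also have "\<dots> \<le> card {v \<in> V. f v = 0}" using f(1) step.prems(1) by (simp add: equitable_coloring_iff)
  finally obtain F where F: "F \<subseteq> {v \<in> V. f v = 0}" "card F = ?n div Suc k"
    using obtain_subset_with_card_n by metis
  have FV: "F \<subseteq> V" "finite F" using F finite_subset[OF _ step.prems(1), of F] by auto
  obtain g where g: "equitable_coloring k (V - F) g" "\<And>i. degenerate_on 1 E {v \<in> V - F. g v = i}"
    using step.IH[of "V - F"] step.prems degenerate_on_subset[of _ E V "V - F"] by auto
  define h where "h v = (if v \<in> F then k else g v)" for v
  have gk: "g v < k" if "v \<in> V - F" for v using g(1) that by (auto simp: equitable_coloring_def)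
  have fib: "{v \<in> V. h v = i} = (if i = k then F else {v \<in> V - F. g v = i})" for i
    using FV gk by (auto simp: h_def)
  have "degenerate_on 1 E F" using degenerate_on_subset[OF f(2) F(1)] .
  then have "degenerate_on 1 E {v \<in> V. h v = i}" for i using g(2) by (simp add: fib)
  moreover have "equitable_coloring (Suc k) V h"
  proof -
    define c where "c = ?n div Suc k"
    define e where "e = ?n mod Suc k"
    have "e \<le> k" by (simp add: e_def less_Suc_eq_le[symmetric])
    have n: "?n = c + k * c + e"
      using div_mult_mod_eq[of ?n "Suc k"] by (simp add: c_def e_def algebra_simps)
    have rest: "card (V - F) = k * c + e" using n F(2) FV by (simp add: card_Diff_subset c_def)
    have "c \<le> card {v \<in> V - F. g v = i} \<and> card {v \<in> V - F. g v = i} \<le> (k * c + e + k - 1) div k" if "i < k" for i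
    proof -
      have "c \<le> (k * c + e) div k" using k by simp
      then show ?thesis using g(1) that step.prems(1) k rest by (fastforce simp: equitable_coloring_iff)
    qed
    \<comment> \<open>With \<open>e \<le> k\<close>, both ceilings equal \<open>c\<close> if
      \<open>e = 0\<close> and \<open>c + 1\<close> otherwise.\<close>
    moreover have "(k * c + e + k - 1) div k = (?n + Suc k - 1) div Suc k"
    proof -
      have "(k * c + e + k - 1) div k = c + (e + k - 1) div k"
      proof -
        have "k * c + e + k - 1 = (e + k - 1) + k * c" using k by simp
        moreover have "((e + k - 1) + k * c) div k = c + (e + k - 1) div k"
          using k by (intro div_mult_self2) simp
        ultimately show ?thesis by (simp only:)
      qed
      moreover have "(?n + Suc k - 1) div Suc k = (e + k + c * Suc k) div Suc k"
        by (simp add: n algebra_simps)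
      moreover have "\<dots> = (e + k) div Suc k + c"
        using div_mult_self1[of "Suc k" "e + k" c] by linarith
      moreover have "(e + k - 1) div k = (e + k) div Suc k"
      proof (cases "e = 0")
        case False
        then have "(e + k - 1) div k = 1" "(e + k) div Suc k = 1"
          using \<open>e \<le> k\<close> k by (intro div_nat_eqI; simp)+
        then show ?thesis by simp
      qed (use k in simp)
      ultimately show ?thesis by simp
    qed
    moreover have "c \<le> (?n + Suc k - 1) div Suc k" unfolding c_def by (intro div_le_mono) simp
    moreover have "h ` V \<subseteq> {..<Suc k}" using gk by (force simp: h_def)
    ultimately show ?thesis
      using step.prems(1) F(2) by (subst equitable_coloring_iff) (auto simp: fib c_def less_Suc_eq)
  qed
  ultimately show ?case by blast
qed

subsection \<open>Induced subgraphs\<close>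

lemma (in graph) graph_induce_subgraph:
  assumes "S \<subseteq> verts G" shows "graph (G \<restriction> S)"
  using induced_induce[OF assms] digraphI_induced induced_graph_imp_graph
  by (intro digraph.graphI sym_digraph.sym_arcs)

text \<open>Without parallel arcs, \<open>head G\<close> is injective on the arcs leaving
  \<open>v\<close>, so counting arcs counts neighbours.\<close>

lemma (in graph) out_degree_induce_subgraph:
  assumes "v \<in> S"
  shows "out_degree (G \<restriction> S) v = card {u \<in> S. v \<rightarrow> u}"
proof -
  have "inj_on (head G) (out_arcs (G \<restriction> S) v)"
    using no_multi_arcs by (auto simp: inj_on_def arc_to_ends_def)
  moreover have "head G ` out_arcs (G \<restriction> S) v = {u \<in> S. v \<rightarrow> u}"
    using assms by (force simp: arcs_ends_conv)
  ultimately show ?thesis by (metis card_image out_degree_def)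
qed

lemma (in graph) degenerate_imp_degenerate_on:
  assumes "degenerate d G"
  shows "degenerate_on d (dominates G) (verts G)"
  unfolding degenerate_on_def
proof (intro allI impI)
  fix W assume W: "W \<subseteq> verts G" "W \<noteq> {}"
  have "subgraph (G \<restriction> W) G" using W(1) by (intro induced_imp_subgraph induced_induce)
  moreover have "verts (G \<restriction> W) \<noteq> {}" using W(2) by simp
  ultimately have "\<exists>v\<in>verts (G \<restriction> W). out_degree (G \<restriction> W) v \<le> d"
    using assms graph_induce_subgraph[OF W(1)] unfolding degenerate_def by blast
  then show "\<exists>v\<in>W. card {u \<in> W. v \<rightarrow> u} \<le> d" using out_degree_induce_subgraph by auto
qed

section \<open>Cycles and forests\<close>

lemma (in pre_digraph) cas_nth:
  "cas u p v \<Longrightarrow> Suc i < length p \<Longrightarrow> tail G (p ! Suc i) = head G (p ! i)"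
proof (induction p arbitrary: u i)
  case (Cons e p)
  then show ?case by (cases i; cases p) auto
qed simp

text \<open>Modular indices treat the return from the last arc to the first like any other
  step.\<close>

lemma (in pre_digraph) cas_closed_nth:
  assumes "cas u p u" "j < length p"
  shows "tail G (p ! (Suc j mod length p)) = head G (p ! j)"
proof (cases "Suc j = length p")
  case True
  have "p \<noteq> []" using assms(2) by auto
  moreover have "q \<noteq> [] \<Longrightarrow> cas x q y \<Longrightarrow> tail G (q ! 0) = x \<and> head G (last q) = y" for x q y
    by (induction q arbitrary: x) (auto simp: cas_simp)
  ultimately show ?thesis
    using True assms last_conv_nth[of p] by (metis diff_Suc_1 mod_self)
next
  case False
  then show ?thesis using assms cas_nth[OF assms(1), of j] by simp
qed

text \<open>On a cycle of length at least 3, every vertex has two distinct neighbours, its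
  predecessor and its successor, so the vertex set of the cycle violates 1-degeneracy.\<close>

lemma (in graph) undirected_forest_induce_subgraph:
  assumes "degenerate_on 1 (dominates G) S"
  shows "undirected_forest (G \<restriction> S)"
  unfolding undirected_forest_def
proof
  assume "\<exists>p. pre_digraph.cycle (G \<restriction> S) p \<and> 3 \<le> length p"
  then obtain p u where p: "3 \<le> length p" "pre_digraph.awalk (G \<restriction> S) u p u"
      "distinct (tl (pre_digraph.awalk_verts (G \<restriction> S) u p))"
    by (auto simp: pre_digraph.cycle_def)
  have compat: "compatible (G \<restriction> S) G" by (simp add: compatible_def)
  have arcs: "set p \<subseteq> arcs (G \<restriction> S)" and cas: "cas u p u"
    using p(2) by (auto simp: pre_digraph.awalk_def compatible_cas[OF compat])
  define n where "n = length p"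
  define x where "x j = head G (p ! j)" for j
  have "p \<noteq> []" using p(1) by auto
  \<comment> \<open>Dropping the first vertex of the walk leaves precisely the heads of its
    arcs.\<close>
  have "distinct (map (head G) p)"
    using p(3) awalk_verts_conv'[OF cas] \<open>p \<noteq> []\<close> by (simp add: compatible_awalk_verts[OF compat])
  then have inj: "x i = x j \<longleftrightarrow> i = j" if "i < n" "j < n" for i j
    using nth_eq_iff_index_eq[of "map (head G) p" i j] that by (simp add: n_def x_def)
  have pj: "p ! j \<in> arcs G \<and> x j \<in> S" if "j < n" for j
    using subsetD[OF arcs nth_mem[of j p]] that by (simp add: n_def x_def)
  have arc: "x j \<rightarrow> x (Suc j mod n)" if "j < n" for j
  proof -
    have "p ! (Suc j mod n) \<in> arcs G" using pj that by simp
    moreover have "arc_to_ends G (p ! (Suc j mod n)) = (x j, x (Suc j mod n))"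
      using cas_closed_nth[OF cas, of j] that by (simp add: arc_to_ends_def x_def n_def)
    ultimately show ?thesis by (rule dominatesI[rotated])
  qed
  define W where "W = x ` {..<n}"
  have "W \<subseteq> S" using pj by (auto simp: W_def)
  moreover have "x 0 \<in> W" unfolding W_def n_def using p(1) by (intro imageI) auto
  then have "W \<noteq> {}" by blast
  ultimately obtain v where v: "v \<in> W" "card {u \<in> W. v \<rightarrow> u} \<le> 1"
    using assms unfolding degenerate_on_def by blast
  then obtain i where i: "i < n" "v = x i" by (auto simp: W_def)
  \<comment> \<open>The cyclic predecessor of \<open>i\<close>.\<close>
  define i' where "i' = (if i = 0 then n - 1 else i - 1)"
  have i': "i' < n" "Suc i' mod n = i" using i(1) by (auto simp: i'_def)
  \<comment> \<open>This is where the length matters: on a closed walk of length 2, predecessor and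
    successor coincide.\<close>
  have ne: "Suc i mod n \<noteq> i'"
    using i(1) p(1) unfolding i'_def n_def by (cases "Suc i = length p") auto
  have lt: "Suc i mod n < n" using i(1) by simp
  have "x i \<rightarrow> x i'" using arc[OF i'(1)] i'(2) graph_symmetric by simp
  moreover have "x (Suc i mod n) \<in> W" "x i' \<in> W" using lt i'(1) unfolding W_def by blast+
  ultimately have "{x (Suc i mod n), x i'} \<subseteq> {u \<in> W. v \<rightarrow> u}"
    using arc[OF i(1)] i(2) by blast
  moreover have "finite {u \<in> W. v \<rightarrow> u}" by (simp add: W_def)
  ultimately have "card {x (Suc i mod n), x i'} \<le> 1" using v(2) card_mono le_trans by blast
  then show False using inj[OF lt i'(1)] ne by simp
qed

theorem theorem9:
  fixes G :: "('a, 'b) pre_digraph" and d k :: nat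
  assumes "d \<ge> 1" and "k \<ge> 3 ^ (d - 1)"
    and "graph G" and "degenerate d G"
  shows "\<exists>S. equitable_partition (verts G) k S \<and>
             (\<forall>i\<in>{1..k}. undirected_forest (G \<restriction> S i))"
proof -
  interpret graph G by fact
  have "degenerate_on (Suc (d - 1)) (dominates G) (verts G)"
    using degenerate_imp_degenerate_on assms(1,4) by simp
  then obtain f where f: "equitable_coloring k (verts G) f"
      "\<And>i. degenerate_on 1 (dominates G) {v \<in> verts G. f v = i}"
    using equitable_forests[of "verts G" "dominates G" "d - 1" k] adj_not_same assms(2) by auto
  \<comment> \<open>Colours start at 0 and parts at 1. Truncated subtraction identifies
    \<open>S 0\<close> with \<open>S 1\<close>, but the index 0 lies outside
    \<open>{1..k}\<close>.\<close>
  define S where "S i = {v \<in> verts G. f v = i - 1}" for i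
  have "\<exists>i\<in>{1..k}. v \<in> S i" if "v \<in> verts G" for v
    using f(1) that by (intro bexI[of _ "Suc (f v)"]) (auto simp: S_def equitable_coloring_def)
  then have "(\<Union>i\<in>{1..k}. S i) = verts G" by (auto simp: S_def)
  moreover have "disjoint_family_on S {1..k}" by (auto simp: S_def disjoint_family_on_def)
  moreover have "\<bar>int (card (S i)) - int (card (S j))\<bar> \<le> 1" if "i \<in> {1..k}" "j \<in> {1..k}" for i j
  proof -
    have "i - 1 < k" "j - 1 < k" using that by auto
    then have "card (S i) \<le> card (S j) + 1" "card (S j) \<le> card (S i) + 1"
      using f(1) by (simp_all add: S_def equitable_coloring_def)
    then show ?thesis by linarith
  qed
  ultimately have "equitable_partition (verts G) k S" by (simp add: equitable_partition_def)
  moreover have "undirected_forest (G \<restriction> S i)" for i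
    unfolding S_def by (rule undirected_forest_induce_subgraph[OF f(2)])
  ultimately show ?thesis by blast
qed

end
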